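(* Let $(\Omega,\mathcal F,\mathbb P)$ be a standard probability space, $(X,d)$ a Polish metric space with base point $x_\circ\in X$, and $1\le p<\infty$. Let $C:\Omega\rightrightarrows X$ be measurable, nonempty compact-valued and $p$-integrably bounded. Then the following are equivalent: (i) $S_p(C)$ is compact in $L^p(\Omega;X)$; (ii) $C(\omega)$ is a singleton for a.e. $\omega\in\Omega_{\rm na}$. In particular, if $(\Omega,\mathcal F,\mathbb P)$ is purely nonatomic, then $S_p(C)$ is compact in $L^p(\Omega;X)$ if and only if $C(\omega)$ is a singleton for a.e. $\omega\in\Omega$.
   Context: Modulo null sets, $\Omega=\Omega_{\rm na}\sqcup\bigsqcup_{j\ge1}A_j$ with $\Omega_{\rm na}$ nonatomic and the $A_j$ (at most countably many) pairwise disjoint atoms of positive measure. $L^p(\Omega;X)$ is the set of a.e.-equivalence classes of strongly measurable $u:\Omega\to X$ with $\int_\Omega d(u(\omega),x_\circ)^p\,d\mathbb P(\omega)<\infty$, with metric $D_p(u,v)=\bigl(\int_\Omega d(u,v)^p\,d\mathbb P\bigr)^{1/p}$. A multifunction $C:\Omega\rightrightarrows X$ with nonempty closed values is measurable if $\{\omega:C(\omega)\cap V\neq\emptyset\}\in\mathcal F$ for every open $V\subset X$. $C$ is $p$-integrably bounded if $r_C(\omega):=\sup_{x\in C(\omega)}d(x,x_\circ)$ belongs to $L^p(\Omega)$. The full selection lift is $S_p(C)=\{u\in L^p(\Omega;X):u(\omega)\in C(\omega)\text{ for a.e. }\omega\}$. *)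

theory Defs
  imports "HOL-Probability.Probability"
begin

section \<open>Standard probability spaces\<close>

definition standard_borel_space :: "'w measure \<Rightarrow> bool" where
  "standard_borel_space M \<longleftrightarrow>
     (\<exists>T. completely_metrizable_space T \<and> separable_space T \<and> topspace T = space M \<and>
          sets M = sigma_sets (space M) {U. openin T U})"

text \<open>
  Conventions differ on whether a standard probability space is a Borel probability measure on a
  standard Borel space, the completion of one, or a space which is one of these only after removing
  a null set (Rokhlin). All three are admitted. Taking \<open>D = space M\<close> gives the first two. An
  isomorphism modulo null sets need not be mentioned, as the Polish topology can be transported
  along it.
\<close>
definition standard_prob_space :: "'w measure \<Rightarrow> bool" where
  "standard_prob_space M \<longleftrightarrow> prob_space M \<and>
     (\<exists>D\<in>sets M. emeasure M D = 1 \<and>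
        (\<exists>N. standard_borel_space N \<and>
             (restrict_space M D = N \<or> restrict_space M D = completion N)))"

section \<open>Atoms\<close>

text \<open>For the finite measures considered here, the last clause says that a measurable subset of
  an atom has either measure zero or full measure in it.\<close>
definition is_atom :: "'w measure \<Rightarrow> 'w set \<Rightarrow> bool" where
  "is_atom M A \<longleftrightarrow> A \<in> sets M \<and> emeasure M A > 0 \<and>
     (\<forall>B\<in>sets M. B \<subseteq> A \<longrightarrow> emeasure M B = 0 \<or> emeasure M B = emeasure M A)"

definition nonatomic_on :: "'w measure \<Rightarrow> 'w set \<Rightarrow> bool" where
  "nonatomic_on M D \<longleftrightarrow> D \<in> sets M \<and> (\<forall>A. A \<subseteq> D \<longrightarrow> \<not> is_atom M A)"

abbreviation purely_nonatomic :: "'w measure \<Rightarrow> bool" where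
  "purely_nonatomic M \<equiv> nonatomic_on M (space M)"

text \<open>\<open>D\<close> is the nonatomic part and \<open>\<A>\<close> the family of atoms; they are disjoint and cover the space
  up to a null set.\<close>
definition atomic_decomposition :: "'w measure \<Rightarrow> 'w set \<Rightarrow> 'w set set \<Rightarrow> bool" where
  "atomic_decomposition M D \<A> \<longleftrightarrow>
     nonatomic_on M D \<and> countable \<A> \<and> (\<forall>A\<in>\<A>. is_atom M A) \<and> disjoint \<A> \<and>
     D \<inter> \<Union>\<A> = {} \<and> space M - (D \<union> \<Union>\<A>) \<in> null_sets M"

section \<open>The metric space $L^p(\Omega;X)$\<close>

definition strongly_measurable :: "'w measure \<Rightarrow> ('w \<Rightarrow> 'x::topological_space) \<Rightarrow> bool" where
  "strongly_measurable M u \<longleftrightarrow>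
     (\<exists>s. (\<forall>i. simple_function M (s i)) \<and> (\<forall>\<omega>\<in>space M. (\<lambda>i::nat. s i \<omega>) \<longlonglongrightarrow> u \<omega>))"

definition Lp_fun :: "'w measure \<Rightarrow> real \<Rightarrow> 'x::metric_space \<Rightarrow> ('w \<Rightarrow> 'x) set" where
  "Lp_fun M p x0 =
     {u. strongly_measurable M u \<and> integrable M (\<lambda>\<omega>. dist (u \<omega>) x0 powr p)}"

definition Lp_rel :: "'w measure \<Rightarrow> real \<Rightarrow> 'x::metric_space \<Rightarrow> (('w \<Rightarrow> 'x) \<times> ('w \<Rightarrow> 'x)) set" where
  "Lp_rel M p x0 =
     {(u, v). u \<in> Lp_fun M p x0 \<and> v \<in> Lp_fun M p x0 \<and> (AE \<omega> in M. u \<omega> = v \<omega>)}"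

definition Lp_class :: "'w measure \<Rightarrow> real \<Rightarrow> 'x::metric_space \<Rightarrow> ('w \<Rightarrow> 'x) \<Rightarrow> ('w \<Rightarrow> 'x) set" where
  "Lp_class M p x0 u = Lp_rel M p x0 `` {u}"

definition Lp_space :: "'w measure \<Rightarrow> real \<Rightarrow> 'x::metric_space \<Rightarrow> ('w \<Rightarrow> 'x) set set" where
  "Lp_space M p x0 = Lp_fun M p x0 // Lp_rel M p x0"

definition Lp_fun_dist :: "'w measure \<Rightarrow> real \<Rightarrow> ('w \<Rightarrow> 'x::metric_space) \<Rightarrow> ('w \<Rightarrow> 'x) \<Rightarrow> real" where
  "Lp_fun_dist M p u v = (\<integral>\<omega>. dist (u \<omega>) (v \<omega>) powr p \<partial>M) powr (1 / p)"

text \<open>The value does not depend on the representatives, see \<open>Lp_dist_class\<close> below.\<close>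
definition Lp_dist :: "'w measure \<Rightarrow> real \<Rightarrow> ('w \<Rightarrow> 'x::metric_space) set \<Rightarrow> ('w \<Rightarrow> 'x) set \<Rightarrow> real" where
  "Lp_dist M p U V = Lp_fun_dist M p (SOME u. u \<in> U) (SOME v. v \<in> V)"

definition Lp_topology :: "'w measure \<Rightarrow> real \<Rightarrow> 'x::metric_space \<Rightarrow> ('w \<Rightarrow> 'x) set topology" where
  "Lp_topology M p x0 = Metric_space.mtopology (Lp_space M p x0) (Lp_dist M p)"

section \<open>Multifunctions and their selections\<close>

definition measurable_multifunction :: "'w measure \<Rightarrow> ('w \<Rightarrow> 'x::topological_space set) \<Rightarrow> bool" where
  "measurable_multifunction M C \<longleftrightarrow>
     (\<forall>\<omega>\<in>space M. C \<omega> \<noteq> {} \<and> closed (C \<omega>)) \<and>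
     (\<forall>V. open V \<longrightarrow> {\<omega>\<in>space M. C \<omega> \<inter> V \<noteq> {}} \<in> sets M)"

text \<open>The boundedness clause says that the supremum is finite almost everywhere, which is part of
  membership in $L^p$ but is not visible in the real-valued \<open>SUP\<close>.\<close>
definition p_integrably_bounded ::
    "'w measure \<Rightarrow> real \<Rightarrow> 'x::metric_space \<Rightarrow> ('w \<Rightarrow> 'x set) \<Rightarrow> bool" where
  "p_integrably_bounded M p x0 C \<longleftrightarrow>
     (AE \<omega> in M. bounded (C \<omega>)) \<and>
     (\<lambda>\<omega>. SUP x\<in>C \<omega>. dist x x0) \<in> borel_measurable M \<and>
     integrable M (\<lambda>\<omega>. \<bar>SUP x\<in>C \<omega>. dist x x0\<bar> powr p)"

definition selection_lift ::
    "'w measure \<Rightarrow> real \<Rightarrow> 'x::metric_space \<Rightarrow> ('w \<Rightarrow> 'x set) \<Rightarrow> ('w \<Rightarrow> 'x) set set" where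
  "selection_lift M p x0 C =
     {Lp_class M p x0 u | u. u \<in> Lp_fun M p x0 \<and> (AE \<omega> in M. u \<omega> \<in> C \<omega>)}"

section \<open>Well-definedness\<close>

lemma strongly_measurable_iff_borel:
  fixes u :: "'w \<Rightarrow> 'x::polish_space"
  shows "strongly_measurable M u \<longleftrightarrow> u \<in> borel_measurable M"
proof
  assume "strongly_measurable M u"
  then obtain s where s: "\<And>i. simple_function M (s i)"
    and lim: "\<And>\<omega>. \<omega> \<in> space M \<Longrightarrow> (\<lambda>i::nat. s i \<omega>) \<longlonglongrightarrow> u \<omega>"
    unfolding strongly_measurable_def by blast
  have "\<And>i. s i \<in> borel_measurable M"
    using s by (rule borel_measurable_simple_function)
  then show "u \<in> borel_measurable M"
    using lim by (rule borel_measurable_LIMSEQ_metric)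
next
  assume "u \<in> borel_measurable M"
  from borel_measurable_implies_sequence_metric[OF this, of undefined]
  show "strongly_measurable M u"
    unfolding strongly_measurable_def by blast
qed

lemma powr_convex_combination:
  fixes p a b x y :: real
  assumes p: "1 \<le> p" and "0 \<le> a" "0 \<le> b" "a + b = 1" "0 \<le> x" "0 \<le> y"
  shows "(a * x + b * y) powr p \<le> a * x powr p + b * y powr p"
proof -
  have *: "(t * z) powr p \<le> t * z powr p" if "0 \<le> t" "t \<le> 1" "0 \<le> z" for t z :: real
  proof -
    have "t powr p \<le> t"
    proof (cases "t = 0")
      case False
      then show ?thesis
        using that p powr_mono'[of 1 p t] by simp
    qed simp
    then have "t powr p * z powr p \<le> t * z powr p"
      by (intro mult_right_mono) auto
    then show ?thesis
      using that by (simp add: powr_mult)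
  qed
  consider "x = 0" | "y = 0" | "0 < x" "0 < y"
    using assms by fastforce
  then show ?thesis
  proof cases
    case 1
    then show ?thesis using *[of b y] assms by simp
  next
    case 2
    then show ?thesis using *[of a x] assms by simp
  next
    case 3
    have "convex_on {0<..} (\<lambda>x::real. x powr p)"
      using p by (rule powr_convex)
    from convex_onD[OF this, of b x y]
    have "((1 - b) * x + b * y) powr p \<le> (1 - b) * x powr p + b * y powr p"
      using 3 assms by simp
    moreover have "1 - b = a" using assms by simp
    ultimately show ?thesis by simp
  qed
qed

lemma add_powr_le:
  fixes p x y :: real
  assumes "1 \<le> p" "0 \<le> x" "0 \<le> y"
  shows "(x + y) powr p \<le> 2 powr p * (x powr p + y powr p)"
proof -
  have "(x + y) powr p \<le> (2 * max x y) powr p"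
    using assms by (intro powr_mono2) auto
  also have "\<dots> = 2 powr p * max x y powr p"
    using assms by (simp add: powr_mult)
  also have "\<dots> \<le> 2 powr p * (x powr p + y powr p)"
    by (intro mult_left_mono) (auto simp: max_def)
  finally show ?thesis .
qed

lemma Lp_fun_dist_integrable:
  fixes u v :: "'w \<Rightarrow> 'x::polish_space"
  assumes "1 \<le> p" and u: "u \<in> Lp_fun M p x0" and v: "v \<in> Lp_fun M p x0"
  shows "integrable M (\<lambda>\<omega>. dist (u \<omega>) (v \<omega>) powr p)"
proof (rule Bochner_Integration.integrable_bound)
  show "integrable M (\<lambda>\<omega>. 2 powr p * (dist (u \<omega>) x0 powr p + dist (v \<omega>) x0 powr p))"
    using u v by (auto simp: Lp_fun_def)
  have [measurable]: "u \<in> borel_measurable M" "v \<in> borel_measurable M"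
    using u v by (auto simp: Lp_fun_def strongly_measurable_iff_borel)
  show "(\<lambda>\<omega>. dist (u \<omega>) (v \<omega>) powr p) \<in> borel_measurable M"
    by measurable
  have "dist (u \<omega>) (v \<omega>) powr p \<le> 2 powr p * (dist (u \<omega>) x0 powr p + dist (v \<omega>) x0 powr p)" for \<omega>
  proof -
    have "dist (u \<omega>) (v \<omega>) powr p \<le> (dist (u \<omega>) x0 + dist (v \<omega>) x0) powr p"
      using assms(1) by (intro powr_mono2 dist_triangle2) auto
    also have "\<dots> \<le> 2 powr p * (dist (u \<omega>) x0 powr p + dist (v \<omega>) x0 powr p)"
      using assms(1) by (intro add_powr_le) auto
    finally show ?thesis .
  qed
  then show "AE \<omega> in M. norm (dist (u \<omega>) (v \<omega>) powr p)
      \<le> norm (2 powr p * (dist (u \<omega>) x0 powr p + dist (v \<omega>) x0 powr p))"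
    by (auto intro!: AE_I2 order_trans[OF _ abs_ge_self])
qed

lemma minkowski:
  fixes f g h :: "'w \<Rightarrow> real"
  assumes p: "1 \<le> p"
    and nn: "\<And>\<omega>. 0 \<le> f \<omega>" "\<And>\<omega>. 0 \<le> g \<omega>" "\<And>\<omega>. 0 \<le> h \<omega>" "\<And>\<omega>. h \<omega> \<le> f \<omega> + g \<omega>"
    and int: "integrable M (\<lambda>\<omega>. f \<omega> powr p)" "integrable M (\<lambda>\<omega>. g \<omega> powr p)"
      "integrable M (\<lambda>\<omega>. h \<omega> powr p)"
  shows "(\<integral>\<omega>. h \<omega> powr p \<partial>M) powr (1/p)
    \<le> (\<integral>\<omega>. f \<omega> powr p \<partial>M) powr (1/p) + (\<integral>\<omega>. g \<omega> powr p \<partial>M) powr (1/p)"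
proof -
  define I where "I k = (\<integral>\<omega>. k \<omega> powr p \<partial>M)" for k :: "'w \<Rightarrow> real"
  define a b where "a = I f powr (1/p)" and "b = I g powr (1/p)"
  have I0: "0 \<le> I k" for k unfolding I_def by simp
  have ab0: "0 \<le> a" "0 \<le> b" unfolding a_def b_def by auto
  have ap: "a powr p = I f" "b powr p = I g"
    using p I0[of f] I0[of g] by (auto simp: a_def b_def powr_powr)
  have zero: "I k powr (1/p) \<le> I l powr (1/p)"
    if "integrable M (\<lambda>\<omega>. k \<omega> powr p)" "integrable M (\<lambda>\<omega>. l \<omega> powr p)"
      "integrable M (\<lambda>\<omega>. m \<omega> powr p)"
      "I m = 0" "\<And>\<omega>. 0 \<le> k \<omega>" "\<And>\<omega>. 0 \<le> m \<omega>" "\<And>\<omega>. k \<omega> \<le> l \<omega> + m \<omega>" for k l m :: "'w \<Rightarrow> real"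
  proof -
    have "AE \<omega> in M. m \<omega> powr p = 0"
      using that(3,4) unfolding I_def by (subst (asm) integral_nonneg_eq_0_iff_AE) auto
    then have "AE \<omega> in M. k \<omega> powr p \<le> l \<omega> powr p"
    proof eventually_elim
      case (elim \<omega>)
      then have "k \<omega> \<le> l \<omega>" using that(7)[of \<omega>] by simp
      then show ?case using that(5) p by (intro powr_mono2) auto
    qed
    then have "I k \<le> I l"
      unfolding I_def using that by (intro integral_mono_AE) auto
    then show ?thesis
      using p I0 by (intro powr_mono2) auto
  qed
  have "I h powr (1/p) \<le> a + b"
  proof (cases "a = 0 \<or> b = 0")
    case True
    then show ?thesis
    proof
      assume "a = 0"
      then have "I f = 0" using ap by simp
      then have "I h powr (1/p) \<le> I g powr (1/p)"
        using nn int by (intro zero[where m = f]) (auto simp: add.commute)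
      then show ?thesis using \<open>a = 0\<close> b_def by simp
    next
      assume "b = 0"
      then have "I g = 0" using ap by simp
      then have "I h powr (1/p) \<le> I f powr (1/p)"
        using nn int by (intro zero[where m = g]) auto
      then show ?thesis using \<open>b = 0\<close> a_def by simp
    qed
  next
    case False
    then have pos: "0 < a" "0 < b" using ab0 by auto
    define s where "s = a + b"
    have s: "0 < s" using pos s_def by simp
    have "h \<omega> powr p \<le> s powr p * (a / s / I f * f \<omega> powr p + b / s / I g * g \<omega> powr p)" for \<omega>
    proof -
      have "h \<omega> powr p \<le> (s * (a / s * (f \<omega> / a) + b / s * (g \<omega> / b))) powr p"
      proof (intro powr_mono2)
        have "s * (a / s * (f \<omega> / a) + b / s * (g \<omega> / b)) = f \<omega> + g \<omega>"
          using pos s by (simp add: field_simps)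
        then show "h \<omega> \<le> s * (a / s * (f \<omega> / a) + b / s * (g \<omega> / b))"
          using nn(4)[of \<omega>] by simp
      qed (use nn p in auto)
      also have "\<dots> = s powr p * (a / s * (f \<omega> / a) + b / s * (g \<omega> / b)) powr p"
        by (rule powr_mult)
      also have "\<dots> \<le> s powr p * (a / s * (f \<omega> / a) powr p + b / s * (g \<omega> / b) powr p)"
      proof (intro mult_left_mono powr_convex_combination)
        show "a / s + b / s = 1"
          using s by (simp add: s_def add_divide_distrib[symmetric])
      qed (use nn p pos s in auto)
      also have "\<dots> = s powr p * (a / s / I f * f \<omega> powr p + b / s / I g * g \<omega> powr p)"
        using nn[of \<omega>] pos by (simp add: powr_divide ap)
      finally show ?thesis .
    qed
    then have "I h \<le> (\<integral>\<omega>. s powr p * (a / s / I f * f \<omega> powr p + b / s / I g * g \<omega> powr p) \<partial>M)"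
      unfolding I_def[of h] using int by (intro integral_mono) auto
    also have "\<dots> = s powr p * (a / s / I f * I f + b / s / I g * I g)"
      using int by (simp add: I_def[symmetric])
    also have "\<dots> = s powr p"
    proof -
      have "I f \<noteq> 0" "I g \<noteq> 0" using ap pos by (metis less_irrefl powr_gt_zero)+
      then show ?thesis using s by (simp add: s_def add_divide_distrib[symmetric])
    qed
    finally have "I h powr (1/p) \<le> (s powr p) powr (1/p)"
      using p I0 by (intro powr_mono2) auto
    also have "\<dots> = s" using p s by (simp add: powr_powr)
    finally show ?thesis unfolding s_def .
  qed
  then show ?thesis unfolding a_def b_def I_def .
qed

lemma Lp_rel_equiv: "equiv (Lp_fun M p x0) (Lp_rel M p x0)"
proof (rule equivI)
  show "trans (Lp_rel M p x0)"
  proof (rule transI)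
    fix u v w assume "(u, v) \<in> Lp_rel M p x0" "(v, w) \<in> Lp_rel M p x0"
    then have *: "u \<in> Lp_fun M p x0" "w \<in> Lp_fun M p x0"
      "AE \<omega> in M. u \<omega> = v \<omega>" "AE \<omega> in M. v \<omega> = w \<omega>"
      unfolding Lp_rel_def by auto
    from *(3,4) have "AE \<omega> in M. u \<omega> = w \<omega>" by eventually_elim simp
    then show "(u, w) \<in> Lp_rel M p x0"
      using * unfolding Lp_rel_def by simp
  qed
  show "sym (Lp_rel M p x0)"
    unfolding Lp_rel_def sym_def by (simp add: eq_commute)
qed (auto simp: Lp_rel_def refl_on_def)

lemma Lp_fun_dist_cong:
  assumes "AE \<omega> in M. u \<omega> = u' \<omega>" "AE \<omega> in M. v \<omega> = v' \<omega>"
    and "u \<in> Lp_fun M p x0" "u' \<in> Lp_fun M p x0" "v \<in> Lp_fun M p x0" "v' \<in> Lp_fun M p x0"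
  shows "Lp_fun_dist M p u v = Lp_fun_dist M p u' (v' :: 'w \<Rightarrow> 'x::polish_space)"
proof -
  have [measurable]: "u \<in> borel_measurable M" "v \<in> borel_measurable M"
    "u' \<in> borel_measurable M" "v' \<in> borel_measurable M"
    using assms(3-6) by (auto simp: Lp_fun_def strongly_measurable_iff_borel)
  have "AE \<omega> in M. dist (u \<omega>) (v \<omega>) powr p = dist (u' \<omega>) (v' \<omega>) powr p"
    using assms(1,2) by eventually_elim simp
  then show ?thesis
    unfolding Lp_fun_dist_def by (subst integral_cong_AE[of _ _ "\<lambda>\<omega>. dist (u' \<omega>) (v' \<omega>) powr p"]) auto
qed

lemma Lp_space_some:
  assumes "U \<in> Lp_space M p x0"
  shows "(SOME u. u \<in> U) \<in> Lp_fun M p x0" "U = Lp_class M p x0 (SOME u. u \<in> U)"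
proof -
  obtain u where u: "u \<in> Lp_fun M p x0" "U = Lp_class M p x0 u"
    using assms unfolding Lp_space_def Lp_class_def by (auto elim: quotientE)
  then have "u \<in> U"
    using equiv_class_self[OF Lp_rel_equiv] unfolding Lp_class_def by blast
  then have *: "(SOME u. u \<in> U) \<in> U" by (auto simp: some_in_eq)
  then have r: "(u, SOME u. u \<in> U) \<in> Lp_rel M p x0"
    using u unfolding Lp_class_def by auto
  then show "(SOME u. u \<in> U) \<in> Lp_fun M p x0" unfolding Lp_rel_def by auto
  show "U = Lp_class M p x0 (SOME u. u \<in> U)"
    using equiv_class_eq[OF Lp_rel_equiv r] u(2) unfolding Lp_class_def by (rule trans[rotated])
qed

lemma Lp_dist_class:
  fixes u v :: "'w \<Rightarrow> 'x::polish_space"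
  assumes u: "u \<in> Lp_fun M p x0" and v: "v \<in> Lp_fun M p x0"
  shows "Lp_dist M p (Lp_class M p x0 u) (Lp_class M p x0 v) = Lp_fun_dist M p u v"
proof -
  have *: "(SOME w'. w' \<in> Lp_class M p x0 w) \<in> Lp_fun M p x0 \<and>
      (AE \<omega> in M. (SOME w'. w' \<in> Lp_class M p x0 w) \<omega> = w \<omega>)"
    if w: "w \<in> Lp_fun M p x0" for w :: "'w \<Rightarrow> 'x"
  proof -
    have "(SOME w'. w' \<in> Lp_class M p x0 w) \<in> Lp_class M p x0 w"
      using equiv_class_self[OF Lp_rel_equiv w] unfolding Lp_class_def some_in_eq by blast
    then have "(w, SOME w'. w' \<in> Lp_class M p x0 w) \<in> Lp_rel M p x0"
      unfolding Lp_class_def by simp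
    then show ?thesis unfolding Lp_rel_def by (simp add: eq_commute)
  qed
  show ?thesis
    unfolding Lp_dist_def using *[OF u] *[OF v] u v by (intro Lp_fun_dist_cong) auto
qed

lemma Metric_space_Lp:
  assumes p: "1 \<le> p"
  shows "Metric_space (Lp_space (M :: 'w measure) p (x0 :: 'x::polish_space)) (Lp_dist M p)"
proof
  fix U V :: "('w \<Rightarrow> 'x) set"
  show "0 \<le> Lp_dist M p U V" unfolding Lp_dist_def Lp_fun_dist_def by simp
  show "Lp_dist M p U V = Lp_dist M p V U"
    unfolding Lp_dist_def Lp_fun_dist_def by (simp add: dist_commute)
next
  fix U V :: "('w \<Rightarrow> 'x) set" assume U: "U \<in> Lp_space M p x0" and V: "V \<in> Lp_space M p x0"
  define u v where "u = (SOME u. u \<in> U)" and "v = (SOME v. v \<in> V)"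
  note u = Lp_space_some[OF U, folded u_def] and v = Lp_space_some[OF V, folded v_def]
  have int: "integrable M (\<lambda>\<omega>. dist (u \<omega>) (v \<omega>) powr p)"
    using Lp_fun_dist_integrable[OF p u(1) v(1)] .
  have "Lp_dist M p U V = 0 \<longleftrightarrow> (\<integral>\<omega>. dist (u \<omega>) (v \<omega>) powr p \<partial>M) = 0"
    unfolding Lp_dist_def Lp_fun_dist_def u_def v_def by simp
  also have "\<dots> \<longleftrightarrow> (AE \<omega> in M. u \<omega> = v \<omega>)"
    using integral_nonneg_eq_0_iff_AE[OF int] by simp
  also have "\<dots> \<longleftrightarrow> (u, v) \<in> Lp_rel M p x0"
    using u v unfolding Lp_rel_def by auto
  also have "\<dots> \<longleftrightarrow> U = V"
    using u v eq_equiv_class_iff[OF Lp_rel_equiv u(1) v(1)] unfolding Lp_class_def by simp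
  finally show "Lp_dist M p U V = 0 \<longleftrightarrow> U = V" .
next
  fix U V W :: "('w \<Rightarrow> 'x) set"
  assume UVW: "U \<in> Lp_space M p x0" "V \<in> Lp_space M p x0" "W \<in> Lp_space M p x0"
  note f = UVW[THEN Lp_space_some(1)]
  show "Lp_dist M p U W \<le> Lp_dist M p U V + Lp_dist M p V W"
    unfolding Lp_dist_def Lp_fun_dist_def
    by (rule minkowski[OF p])
      (use f Lp_fun_dist_integrable[OF p] in \<open>auto intro: dist_triangle\<close>)
qed

lemma (in finite_measure) atomic_decomposition_exists: "\<exists>D \<A>. atomic_decomposition M D \<A>"
proof -
  define S where "S = {\<A>. (\<forall>A\<in>\<A>. is_atom M A) \<and> disjoint \<A>}"
  have "\<exists>\<A>\<in>S. \<forall>\<B>\<in>S. \<A> \<subseteq> \<B> \<longrightarrow> \<B> = \<A>"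
  proof (rule subset_Zorn')
    fix c assume c: "subset.chain S c"
    show "\<Union>c \<in> S"
    proof -
      have "disjnt A B" if "A \<in> \<Union>c" "B \<in> \<Union>c" "A \<noteq> B" for A B
      proof -
        obtain X Y where XY: "X \<in> c" "A \<in> X" "Y \<in> c" "B \<in> Y" using \<open>A \<in> \<Union>c\<close> \<open>B \<in> \<Union>c\<close> by blast
        moreover have "X \<subseteq> Y \<or> Y \<subseteq> X" using c XY unfolding subset_chain_def by auto
        ultimately obtain Z where "Z \<in> c" "A \<in> Z" "B \<in> Z" by auto
        then show ?thesis using c \<open>A \<noteq> B\<close> unfolding S_def subset_chain_def pairwise_def by blast
      qed
      then show ?thesis
        using c unfolding S_def subset_chain_def pairwise_def by blast
    qed
  qed
  then obtain \<A> where \<A>: "\<A> \<in> S" and max: "\<And>\<B>. \<B> \<in> S \<Longrightarrow> \<A> \<subseteq> \<B> \<Longrightarrow> \<B> = \<A>"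
    by blast
  have at: "is_atom M A" if "A \<in> \<A>" for A using \<A> that S_def by auto
  have disj: "disjoint \<A>" using \<A> S_def by auto
  have "countable \<A>"
  proof -
    have "(\<Sum>A\<in>F. measure M A) \<le> measure M (space M)" if "finite F" "F \<subseteq> \<A>" for F
    proof -
      have "disjoint_family_on (\<lambda>A. A) F"
        using that(2) disj unfolding disjoint_family_on_def disjoint_def by blast
      moreover have "(\<lambda>A. A) ` F \<subseteq> sets M"
        using that at by (auto simp: is_atom_def)
      ultimately have "(\<Sum>A\<in>F. measure M A) = measure M (\<Union>A\<in>F. A)"
        using that by (intro finite_measure_finite_Union[symmetric])
      also have "\<dots> \<le> measure M (space M)" by (rule bounded_measure)
      finally show ?thesis .
    qed
    then have "(\<lambda>A. measure M A) summable_on \<A>"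
      by (intro nonneg_bdd_above_summable_on bdd_aboveI[where M = "measure M (space M)"]) auto
    then have "countable {A\<in>\<A>. measure M A \<noteq> 0}"
      by (rule summable_countable_real)
    moreover have "{A\<in>\<A>. measure M A \<noteq> 0} = \<A>"
      using at by (fastforce simp: is_atom_def emeasure_eq_measure)
    ultimately show ?thesis by simp
  qed
  define D where "D = space M - \<Union>\<A>"
  have sets: "\<Union>\<A> \<in> sets M"
    using \<open>countable \<A>\<close> at by (intro sets.countable_Union) (auto simp: is_atom_def)
  have "\<not> is_atom M A" if "A \<subseteq> D" for A
  proof
    assume A: "is_atom M A"
    then have "insert A \<A> \<in> S"
      using at disj that unfolding S_def D_def by (auto simp: pairwise_insert disjnt_def)
    then have "A \<in> \<A>" using max by blast
    then have "A = {}" using that D_def by auto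
    then show False using A by (simp add: is_atom_def)
  qed
  then have "atomic_decomposition M D \<A>"
    unfolding atomic_decomposition_def nonatomic_on_def
    using sets \<open>countable \<A>\<close> at disj sets.sets_into_space[OF sets] by (auto simp: D_def Un_absorb2)
  then show ?thesis by blast
qed

end

theory Submission
  imports Defs "HOL-Real_Asymp.Real_Asymp"
begin

text \<open>
  Suppose first that the lift is compact, hence totally bounded, while \<open>C\<close> takes two different values
  on a part of the nonatomic set \<open>D\<close> that is not null. By separability there are two balls, far apart
  compared with their radius, such that \<open>C\<close> meets both of them on a set \<open>B \<subseteq> D\<close> of positive measure
  (\<open>compact_lift_imp_singleton\<close>). The selection theorem of Kuratowski and Ryll-Nardzewski gives
  selections \<open>u\<close> and \<open>v\<close> which on \<open>B\<close> stay close to the first and to the second ball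
  (\<open>measurable_selection_hitting\<close>), so that they are uniformly apart there. Switching from \<open>v\<close> to \<open>u\<close>
  on a subset \<open>E\<close> of \<open>B\<close> gives again a selection. Each element \<open>g\<close> of a finite net is, at every point
  of \<open>B\<close>, far from \<open>u\<close> or far from \<open>v\<close>, and thus determines a set \<open>F\<close> where it is closer to \<open>u\<close>. Since
  there are no atoms in \<open>B\<close>, some \<open>E\<close> differs from all of these finitely many sets \<open>F\<close> on a third of
  \<open>B\<close> (\<open>nonatomic_on_split_finite_family\<close>); the selection switched along this \<open>E\<close> is far from
  the whole net, a contradiction (\<open>compact_lift_imp_two_ball_null\<close>).

  Conversely, let \<open>C\<close> be single-valued on \<open>D\<close>. All selections agree on \<open>D\<close>, and on each atom a
  selection is almost everywhere constant (\<open>AE_constant_on_atom\<close>), so a selection amounts to a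
  countable family of points, one in a compact set for each atom. Tychonoff's theorem then provides
  almost everywhere convergent subsequences (\<open>selections_AE_convergent_subsequence\<close>), and dominated
  convergence, with the integrable bound of \<open>C\<close>, turns this into convergence in $L^p$
  (\<open>selections_Lp_tendsto\<close>).
\<close>

section \<open>Measurable selections\<close>

lemma dense_sequence_exists:
  "\<exists>q :: nat \<Rightarrow> 'x::polish_space. \<forall>x e. 0 < e \<longrightarrow> (\<exists>n. dist (q n) x < e)"
proof -
  obtain D :: "'x set" where D: "countable D" "\<And>X. open X \<Longrightarrow> X \<noteq> {} \<Longrightarrow> \<exists>d\<in>D. d \<in> X"
    by (rule countable_dense_setE) blast
  have "\<exists>n. dist (from_nat_into D n) x < e" if "0 < e" for x e
  proof -
    obtain d where "d \<in> D" "d \<in> ball x e"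
      using D(2)[of "ball x e"] \<open>0 < e\<close> by (auto simp: mem_ball)
    moreover obtain n where "from_nat_into D n = d"
      using from_nat_into_surj[OF D(1) \<open>d \<in> D\<close>] by blast
    ultimately show ?thesis by (auto simp: dist_commute intro!: exI[of _ n])
  qed
  then show ?thesis by blast
qed

text \<open>
  The theorem of Kuratowski and Ryll-Nardzewski. The selection is the limit of functions \<open>q (idx k \<omega>)\<close>
  with values in a dense sequence, each within \<open>r k\<close> of \<open>F \<omega>\<close>. Choosing always the least admissible
  index makes them measurable, as the value is then determined by countably many conditions of the
  form \<open>F \<omega> \<inter> V \<noteq> {}\<close> with \<open>V\<close> open.
\<close>
lemma measurable_selection:
  fixes F :: "'w \<Rightarrow> 'x::polish_space set"
  assumes F: "measurable_multifunction M F"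
  obtains f where "f \<in> borel_measurable M" "\<And>\<omega>. \<omega> \<in> space M \<Longrightarrow> f \<omega> \<in> F \<omega>"
proof -
  have hit: "Measurable.pred M (\<lambda>\<omega>. F \<omega> \<inter> V \<noteq> {})" if "open V" for V
    using F that unfolding measurable_multifunction_def pred_def by blast
  obtain q :: "nat \<Rightarrow> 'x" where q: "\<And>x e. 0 < e \<Longrightarrow> \<exists>n. dist (q n) x < e"
    using dense_sequence_exists by blast
  define r :: "nat \<Rightarrow> real" where "r k = (1/2) ^ k" for k
  have r: "0 < r k" "r (Suc k) = r k / 2" for k unfolding r_def by auto
  \<comment> \<open>A new ball must meet the set inside the previous ball; this keeps consecutive centres close.\<close>
  define idx where "idx = rec_nat (\<lambda>\<omega>. LEAST n. F \<omega> \<inter> ball (q n) (r 0) \<noteq> {})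
    (\<lambda>k g \<omega>. LEAST n. F \<omega> \<inter> (ball (q n) (r (Suc k)) \<inter> ball (q (g \<omega>)) (r k)) \<noteq> {})"
  have idx0: "idx 0 \<omega> = (LEAST n. F \<omega> \<inter> ball (q n) (r 0) \<noteq> {})"
    and idxS: "idx (Suc k) \<omega> =
      (LEAST n. F \<omega> \<inter> (ball (q n) (r (Suc k)) \<inter> ball (q (idx k \<omega>)) (r k)) \<noteq> {})" for k \<omega>
    unfolding idx_def by simp_all
  have idx_meas: "idx k \<in> M \<rightarrow>\<^sub>M count_space UNIV" for k
  proof (induction k)
    case 0
    have "(\<lambda>\<omega>. LEAST n. F \<omega> \<inter> ball (q n) (r 0) \<noteq> {}) \<in> M \<rightarrow>\<^sub>M count_space UNIV"
      by (intro measurable_Least hit) auto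
    then show ?case unfolding idx0[abs_def, symmetric] .
  next
    case (Suc k)
    have "(\<lambda>\<omega>. LEAST n. F \<omega> \<inter> (ball (q n) (r (Suc k)) \<inter> ball (q (idx k \<omega>)) (r k)) \<noteq> {})
      \<in> M \<rightarrow>\<^sub>M count_space UNIV"
    proof (intro measurable_Least)
      fix n
      show "Measurable.pred M
          (\<lambda>\<omega>. F \<omega> \<inter> (ball (q n) (r (Suc k)) \<inter> ball (q (idx k \<omega>)) (r k)) \<noteq> {})"
        by (rule measurable_compose_countable[OF hit Suc]) auto
    qed
    then show ?case unfolding idxS[abs_def, symmetric] .
  qed
  have meets: "F \<omega> \<inter> ball (q (idx k \<omega>)) (r k) \<noteq> {}" if "\<omega> \<in> space M" for k \<omega>
  proof (induction k)
    case 0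
    have "F \<omega> \<noteq> {}" using F that unfolding measurable_multifunction_def by blast
    then obtain y where "y \<in> F \<omega>" by blast
    moreover obtain n where "dist (q n) y < r 0" using q r by blast
    ultimately have "F \<omega> \<inter> ball (q n) (r 0) \<noteq> {}" by auto
    then show ?case unfolding idx0 by (rule LeastI)
  next
    case (Suc k)
    then obtain y where "y \<in> F \<omega>" "y \<in> ball (q (idx k \<omega>)) (r k)" by blast
    moreover obtain n where "dist (q n) y < r (Suc k)" using q r by blast
    ultimately have "F \<omega> \<inter> (ball (q n) (r (Suc k)) \<inter> ball (q (idx k \<omega>)) (r k)) \<noteq> {}" by auto
    then have "F \<omega> \<inter> (ball (q (idx (Suc k) \<omega>)) (r (Suc k)) \<inter> ball (q (idx k \<omega>)) (r k)) \<noteq> {}"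
      unfolding idxS by (rule LeastI)
    then show ?case by blast
  qed
  have step: "dist (q (idx k \<omega>)) (q (idx (Suc k) \<omega>)) < 2 * r k" if "\<omega> \<in> space M" for k \<omega>
  proof -
    have "F \<omega> \<inter> ball (q (idx k \<omega>)) (r k) \<noteq> {}" using that by (rule meets)
    then obtain y where y: "y \<in> F \<omega>" "y \<in> ball (q (idx k \<omega>)) (r k)" by blast
    obtain n where "dist (q n) y < r (Suc k)" using q r by blast
    then have "F \<omega> \<inter> (ball (q n) (r (Suc k)) \<inter> ball (q (idx k \<omega>)) (r k)) \<noteq> {}" using y by auto
    then have "F \<omega> \<inter> (ball (q (idx (Suc k) \<omega>)) (r (Suc k)) \<inter> ball (q (idx k \<omega>)) (r k)) \<noteq> {}"
      unfolding idxS by (rule LeastI)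
    then obtain z where "dist (q (idx (Suc k) \<omega>)) z < r (Suc k)" "dist (q (idx k \<omega>)) z < r k" by auto
    then show ?thesis
      using dist_triangle2[of "q (idx k \<omega>)" "q (idx (Suc k) \<omega>)" z] r(1)[of k] r(2)[of k] by linarith
  qed
  \<comment> \<open>The bound is written as a difference so that the induction on \<open>m\<close> telescopes.\<close>
  have tail: "dist (q (idx k \<omega>)) (q (idx (k + m) \<omega>)) \<le> 4 * r k - 4 * r (k + m)"
    if "\<omega> \<in> space M" for k m \<omega>
  proof (induction m)
    case (Suc m)
    then show ?case
      using step[OF that, of "k + m"] r(2)[of "k + m"]
        dist_triangle[of "q (idx k \<omega>)" "q (idx (k + Suc m) \<omega>)" "q (idx (k + m) \<omega>)"] by simp
  qed simp
  have r_lim: "r \<longlonglongrightarrow> 0" unfolding r_def by (rule LIMSEQ_power_zero) simp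
  have Cauchy: "Cauchy (\<lambda>k. q (idx k \<omega>))" if "\<omega> \<in> space M" for \<omega>
  proof (rule metric_CauchyI)
    fix e :: real assume "0 < e"
    then obtain N where N: "r N < e / 8"
      using order_tendstoD(2)[OF r_lim, of "e/8"] by (auto simp: eventually_sequentially)
    have "dist (q (idx N \<omega>)) (q (idx m \<omega>)) < e / 2" if "m \<ge> N" for m
      using tail[OF \<open>\<omega> \<in> space M\<close>, of N "m - N"] that N r(1)[of m] by simp
    then show "\<exists>N. \<forall>m\<ge>N. \<forall>n\<ge>N. dist (q (idx m \<omega>)) (q (idx n \<omega>)) < e"
      by (meson dist_triangle_half_r)
  qed
  define f where "f \<omega> = lim (\<lambda>k. q (idx k \<omega>))" for \<omega>
  have f: "(\<lambda>k. q (idx k \<omega>)) \<longlonglongrightarrow> f \<omega>" if "\<omega> \<in> space M" for \<omega>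
    using Cauchy_convergent[OF Cauchy[OF that]] unfolding f_def convergent_LIMSEQ_iff .
  show thesis
  proof
    have "(\<lambda>\<omega>. q (idx k \<omega>)) \<in> borel_measurable M" for k
      using measurable_compose[OF idx_meas, of q borel k] by simp
    then show "f \<in> borel_measurable M" using f by (rule borel_measurable_LIMSEQ_metric)
  next
    fix \<omega> assume \<omega>: "\<omega> \<in> space M"
    obtain y where y: "\<And>k. y k \<in> F \<omega>" "\<And>k. dist (q (idx k \<omega>)) (y k) < r k"
      using meets[OF \<omega>] unfolding disjoint_iff mem_ball by metis
    have "dist (y k) (f \<omega>) \<le> r k + dist (q (idx k \<omega>)) (f \<omega>)" for k
      using dist_triangle[of "y k" "f \<omega>" "q (idx k \<omega>)"] y(2)[of k] by (simp add: dist_commute)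
    moreover have "(\<lambda>k. r k + dist (q (idx k \<omega>)) (f \<omega>)) \<longlonglongrightarrow> 0"
      using tendsto_add[OF r_lim tendsto_dist_iff[THEN iffD1, OF f[OF \<omega>]]] by simp
    ultimately have "(\<lambda>k. dist (y k) (f \<omega>)) \<longlonglongrightarrow> 0"
      by - (rule real_tendsto_sandwich[OF _ _ tendsto_const], auto)
    then have "y \<longlonglongrightarrow> f \<omega>" by (rule tendsto_dist_iff[THEN iffD2])
    moreover have "closed (F \<omega>)" using F \<omega> unfolding measurable_multifunction_def by blast
    ultimately show "f \<omega> \<in> F \<omega>" using y(1) by (meson closed_sequentially)
  qed
qed

text \<open>
  Where \<open>C \<omega>\<close> meets \<open>V\<close> it is replaced by the closure of \<open>C \<omega> \<inter> V\<close>. An open set meets this closure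
  iff it meets \<open>C \<omega> \<inter> V\<close>, so the new multifunction is still measurable.
\<close>
lemma measurable_selection_hitting:
  fixes C :: "'w \<Rightarrow> 'x::polish_space set"
  assumes C: "measurable_multifunction M C" and V: "open V"
  obtains f where "f \<in> borel_measurable M" "\<And>\<omega>. \<omega> \<in> space M \<Longrightarrow> f \<omega> \<in> C \<omega>"
    "\<And>\<omega>. \<omega> \<in> space M \<Longrightarrow> C \<omega> \<inter> V \<noteq> {} \<Longrightarrow> f \<omega> \<in> closure V"
proof -
  define F where "F \<omega> = (if C \<omega> \<inter> V \<noteq> {} then closure (C \<omega> \<inter> V) else C \<omega>)" for \<omega>
  have hit: "{\<omega>\<in>space M. C \<omega> \<inter> U \<noteq> {}} \<in> sets M" if "open U" for U
    using C that unfolding measurable_multifunction_def by blast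
  have "{\<omega>\<in>space M. F \<omega> \<inter> U \<noteq> {}} \<in> sets M" if "open U" for U
  proof -
    have "{\<omega>\<in>space M. F \<omega> \<inter> U \<noteq> {}} = {\<omega>\<in>space M. C \<omega> \<inter> (V \<inter> U) \<noteq> {}} \<union>
        ({\<omega>\<in>space M. C \<omega> \<inter> U \<noteq> {}} - {\<omega>\<in>space M. C \<omega> \<inter> V \<noteq> {}})"
      using open_Int_closure_eq_empty[OF that] by (auto simp: F_def Int_commute Int_left_commute)
    then show ?thesis using hit[OF that] hit[OF V] hit[of "V \<inter> U"] V that by auto
  qed
  then have "measurable_multifunction M F"
    using C unfolding measurable_multifunction_def F_def by (auto simp: closure_eq_empty)
  then obtain f where f: "f \<in> borel_measurable M" "\<And>\<omega>. \<omega> \<in> space M \<Longrightarrow> f \<omega> \<in> F \<omega>"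
    using measurable_selection[of M F] by metis
  have "closure (C \<omega> \<inter> V) \<subseteq> C \<omega>" if "\<omega> \<in> space M" for \<omega>
    using C that unfolding measurable_multifunction_def by (intro closure_minimal) auto
  moreover have "closure (C \<omega> \<inter> V) \<subseteq> closure V" for \<omega>
    by (intro closure_mono) auto
  ultimately show thesis using f(2) by (intro that[OF f(1)]) (fastforce simp: F_def split: if_splits)+
qed

section \<open>Splitting sets without atoms\<close>

text \<open>
  A weak form of Sierpinski's theorem on the range of a nonatomic measure, proved by exhaustion. If no
  subset had a measure in the middle third, every subset would be either small (less than a third) or
  large (more than two thirds), and the union of two small sets would be small again. A small set of
  maximal measure then exists, but its complement is not an atom and so contains another small set of
  positive measure, which contradicts maximality.
\<close>
lemma (in finite_measure) nonatomic_on_split: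
  assumes D: "nonatomic_on M D" and A: "A \<in> sets M" "A \<subseteq> D"
  obtains (split) E where "E \<in> sets M" "E \<subseteq> A"
    "measure M A / 3 \<le> measure M E" "measure M A / 3 \<le> measure M (A - E)"
proof (rule ccontr)
  assume neg: "\<not> thesis"
  define a where "a = measure M A"
  have dich: "measure M E < a / 3 \<or> 2 * a / 3 < measure M E" if "E \<in> sets M" "E \<subseteq> A" for E
  proof -
    have "measure M (A - E) = a - measure M E"
      unfolding a_def using A that by (intro finite_measure_Diff) auto
    moreover have "\<not> (a / 3 \<le> measure M E \<and> a / 3 \<le> measure M (A - E))"
      using neg that split unfolding a_def by blast
    ultimately show ?thesis by linarith
  qed
  have a: "0 < a"
    using dich[of "{}"] unfolding a_def by auto
  define S where "S = {E\<in>sets M. E \<subseteq> A \<and> measure M E < a / 3}"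
  have S_Un: "E \<union> F \<in> S" if "E \<in> S" "F \<in> S" for E F
  proof -
    have "measure M (E \<union> F) \<le> measure M E + measure M F"
      using that unfolding S_def by (intro measure_subadditive) (auto simp: emeasure_eq_measure)
    then have "\<not> 2 * a / 3 < measure M (E \<union> F)" using that unfolding S_def by auto
    then show ?thesis using dich[of "E \<union> F"] that unfolding S_def by auto
  qed
  define s where "s = (SUP E\<in>S. measure M E)"
  have bdd: "bdd_above (measure M ` S)" unfolding S_def by (intro bdd_aboveI[of _ "a/3"]) auto
  have "{} \<in> S" using a by (simp add: S_def)
  have "\<exists>E\<in>S. s - 1 / real (Suc n) < measure M E" for n
  proof -
    have "s - 1 / real (Suc n) < (SUP E\<in>S. measure M E)" unfolding s_def[symmetric] by simp
    then show ?thesis using \<open>{} \<in> S\<close> bdd by (subst (asm) less_cSUP_iff) auto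
  qed
  then obtain F where F: "\<And>n. F n \<in> S" "\<And>n. s - 1 / real (Suc n) < measure M (F n)" by metis
  define G where "G n = (\<Union>i\<le>n. F i)" for n
  have G: "G n \<in> S" for n
  proof (induction n)
    case 0 then show ?case using F(1)[of 0] by (simp add: G_def)
  next
    case (Suc n)
    then show ?case using S_Un[OF F(1)[of "Suc n"] Suc] by (simp add: G_def atMost_Suc)
  qed
  then have G_sets: "range G \<subseteq> sets M" unfolding S_def by auto
  define H where "H = (\<Union>n. G n)"
  have H_meas: "H \<in> sets M" "H \<subseteq> A" using G unfolding H_def S_def by auto
  have "incseq G" unfolding G_def by (intro incseq_SucI UN_mono) auto
  then have lim: "(\<lambda>n. measure M (G n)) \<longlonglongrightarrow> measure M H"
    unfolding H_def using G_sets by (intro finite_Lim_measure_incseq)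
  have "measure M H \<le> a / 3"
    by (rule LIMSEQ_le_const2[OF lim]) (use G in \<open>auto simp: S_def intro: less_imp_le\<close>)
  then have HS: "H \<in> S" using dich[OF H_meas] a H_meas unfolding S_def by auto
  have s_le: "s \<le> measure M H"
  proof (rule LIMSEQ_le_const2)
    show "(\<lambda>n. s - 1 / real (Suc n)) \<longlonglongrightarrow> s" by real_asymp
    have "s - 1 / real (Suc n) \<le> measure M H" for n
    proof -
      have "measure M (F n) \<le> measure M H"
        using H_meas unfolding H_def G_def by (intro finite_measure_mono) auto
      then show ?thesis using F(2)[of n] by linarith
    qed
    then show "\<exists>N. \<forall>n\<ge>N. s - 1 / real (Suc n) \<le> measure M H" by blast
  qed
  have le_s: "measure M E \<le> s" if "E \<in> S" for E
    unfolding s_def using bdd that by (rule cSUP_upper[rotated])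
  define R where "R = A - H"
  have R: "R \<in> sets M" "R \<subseteq> A" "measure M R = a - measure M H"
    unfolding R_def a_def using A H_meas by (auto intro: finite_measure_Diff)
  have "0 < measure M R" using R(3) HS a unfolding S_def by auto
  moreover have "\<not> is_atom M R" using D R A unfolding nonatomic_on_def by blast
  ultimately obtain B where B: "B \<in> sets M" "B \<subseteq> R" "measure M B \<noteq> 0" "measure M B \<noteq> measure M R"
    unfolding is_atom_def using R by (auto simp: emeasure_eq_measure)
  have RB: "measure M (R - B) = measure M R - measure M B"
    using R B by (intro finite_measure_Diff) auto
  have "\<exists>K\<in>S. K \<subseteq> R \<and> 0 < measure M K"
  proof (cases "measure M B < a / 3")
    case True
    then show ?thesis using B R unfolding S_def by (intro bexI[of _ B]) (auto simp: zero_less_measure_iff)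
  next
    case False
    then have "2 * a / 3 < measure M B" using dich[of B] B R by auto
    moreover have "measure M R \<le> a" using R(3) by simp
    ultimately have "measure M (R - B) < a / 3" using RB by linarith
    moreover have "measure M B \<le> measure M R" using R B by (intro finite_measure_mono) auto
    ultimately show ?thesis using B R RB unfolding S_def by (intro bexI[of _ "R - B"]) auto
  qed
  then obtain K where K: "K \<in> S" "K \<subseteq> R" "0 < measure M K" by blast
  have "measure M (H \<union> K) = measure M H + measure M K"
    using K H_meas unfolding S_def R_def by (intro finite_measure_Union) auto
  then show False using s_le le_s[OF S_Un[OF HS K(1)]] K(3) by linarith
qed

text \<open>
  The set \<open>E\<close> has to differ from every \<open>F \<in> \<F>\<close> on a third of \<open>A\<close>. For the induction on \<open>\<F>\<close> it has to
  differ in this way also from \<open>{}\<close> and from \<open>A\<close>: a new set \<open>G\<close> cuts \<open>A\<close> into \<open>A \<inter> G\<close> and \<open>A - G\<close>, on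
  which \<open>G\<close> is the whole and the empty set, respectively. Treating both parts separately and taking
  the union of the results gives a set for the enlarged family.
\<close>
lemma (in finite_measure) nonatomic_on_split_finite_family:
  assumes D: "nonatomic_on M D" and "finite \<F>" "\<F> \<subseteq> sets M" and A: "A \<in> sets M" "A \<subseteq> D"
  shows "\<exists>E\<in>sets M. E \<subseteq> A \<and> measure M A / 3 \<le> measure M E \<and> measure M A / 3 \<le> measure M (A - E) \<and>
    (\<forall>F\<in>\<F>. measure M A / 3 \<le> measure M ((E - F) \<union> (A \<inter> F - E)))"
  using \<open>finite \<F>\<close> \<open>\<F> \<subseteq> sets M\<close> A
proof (induction \<F> arbitrary: A rule: finite_induct)
  case empty
  then show ?case using nonatomic_on_split[OF D, of A] by (metis empty_iff)
next
  case (insert G \<F>)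
  define A1 A2 where "A1 = A \<inter> G" and "A2 = A - G"
  have A12: "A1 \<in> sets M" "A1 \<subseteq> D" "A2 \<in> sets M" "A2 \<subseteq> D" "A = A1 \<union> A2" "A1 \<inter> A2 = {}"
    using insert.prems unfolding A1_def A2_def by auto
  obtain E1 where E1: "E1 \<in> sets M" "E1 \<subseteq> A1" "measure M A1 / 3 \<le> measure M E1"
    "measure M A1 / 3 \<le> measure M (A1 - E1)"
    "\<And>F. F \<in> \<F> \<Longrightarrow> measure M A1 / 3 \<le> measure M ((E1 - F) \<union> (A1 \<inter> F - E1))"
    using insert.IH[of A1] insert.prems A12 by auto
  obtain E2 where E2: "E2 \<in> sets M" "E2 \<subseteq> A2" "measure M A2 / 3 \<le> measure M E2"
    "measure M A2 / 3 \<le> measure M (A2 - E2)"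
    "\<And>F. F \<in> \<F> \<Longrightarrow> measure M A2 / 3 \<le> measure M ((E2 - F) \<union> (A2 \<inter> F - E2))"
    using insert.IH[of A2] insert.prems A12 by auto
  have add: "measure M A / 3 \<le> measure M P"
    if "P = P1 \<union> P2" "P1 \<in> sets M" "P2 \<in> sets M" "P1 \<subseteq> A1" "P2 \<subseteq> A2"
      "measure M A1 / 3 \<le> measure M P1" "measure M A2 / 3 \<le> measure M P2" for P P1 P2
  proof -
    have "measure M A = measure M A1 + measure M A2"
      using A12 by (auto intro: finite_measure_Union)
    moreover have "measure M P = measure M P1 + measure M P2"
      using that A12 by (auto intro!: finite_measure_Union)
    ultimately show ?thesis using that by simp
  qed
  show ?case
  proof (intro bexI[of _ "E1 \<union> E2"] conjI ballI)
    show "E1 \<union> E2 \<subseteq> A" "E1 \<union> E2 \<in> sets M" using E1 E2 A12 by auto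
    show "measure M A / 3 \<le> measure M (E1 \<union> E2)" by (rule add) (use E1 E2 in auto)
    show "measure M A / 3 \<le> measure M (A - (E1 \<union> E2))"
      by (rule add[of _ "A1 - E1" "A2 - E2"]) (use E1 E2 A12 in auto)
    fix F assume "F \<in> insert G \<F>"
    then consider "F = G" | "F \<in> \<F>" by blast
    then show "measure M A / 3 \<le> measure M ((E1 \<union> E2 - F) \<union> (A \<inter> F - (E1 \<union> E2)))"
    proof cases
      case 1
      show ?thesis
      proof (rule add[of _ "A1 - E1" E2])
        have "E1 \<subseteq> G" "E2 \<inter> G = {}" "E2 \<subseteq> A" using E1(2) E2(2) unfolding A1_def A2_def by auto
        then show "(E1 \<union> E2 - F) \<union> (A \<inter> F - (E1 \<union> E2)) = (A1 - E1) \<union> E2"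
          unfolding 1 A1_def by blast
      qed (use E1 E2 A12 in auto)
    next
      case 2
      then have "F \<in> sets M" using insert.prems by auto
      with 2 show ?thesis
        by (intro add[of _ "(E1 - F) \<union> (A1 \<inter> F - E1)" "(E2 - F) \<union> (A2 \<inter> F - E2)"])
          (use E1 E2 A12 in auto)
    qed
  qed
qed

section \<open>Selections of integrably bounded multifunctions\<close>

lemma p_integrably_bounded_AE:
  assumes "p_integrably_bounded M p x0 C"
  shows "AE \<omega> in M. \<forall>x\<in>C \<omega>. dist x x0 \<le> \<bar>SUP y\<in>C \<omega>. dist y x0\<bar>"
proof -
  have "AE \<omega> in M. bounded (C \<omega>)" using assms unfolding p_integrably_bounded_def by blast
  then show ?thesis
  proof eventually_elim
    case (elim \<omega>)
    then obtain e where "\<forall>y\<in>C \<omega>. dist x0 y \<le> e" unfolding bounded_any_center[of _ x0] by blast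
    then have "bdd_above ((\<lambda>y. dist y x0) ` C \<omega>)" by (auto intro!: bdd_aboveI simp: dist_commute)
    then show ?case by (auto intro: order_trans[OF cSUP_upper abs_ge_self])
  qed
qed

lemma selection_in_Lp_fun:
  fixes u :: "'w \<Rightarrow> 'x::polish_space"
  assumes p: "1 \<le> p" and bd: "p_integrably_bounded M p x0 C"
    and u[measurable]: "u \<in> borel_measurable M" and sel: "AE \<omega> in M. u \<omega> \<in> C \<omega>"
  shows "u \<in> Lp_fun M p x0"
proof -
  have "integrable M (\<lambda>\<omega>. dist (u \<omega>) x0 powr p)"
  proof (rule Bochner_Integration.integrable_bound)
    show "integrable M (\<lambda>\<omega>. \<bar>SUP x\<in>C \<omega>. dist x x0\<bar> powr p)"
      using bd unfolding p_integrably_bounded_def by blast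
    show "(\<lambda>\<omega>. dist (u \<omega>) x0 powr p) \<in> borel_measurable M" by measurable
    show "AE \<omega> in M. norm (dist (u \<omega>) x0 powr p) \<le> norm (\<bar>SUP x\<in>C \<omega>. dist x x0\<bar> powr p)"
      using p_integrably_bounded_AE[OF bd] sel
    proof eventually_elim
      case (elim \<omega>)
      then have "dist (u \<omega>) x0 powr p \<le> \<bar>SUP x\<in>C \<omega>. dist x x0\<bar> powr p"
        using p by (intro powr_mono2) auto
      then show ?case by simp
    qed
  qed
  then show ?thesis unfolding Lp_fun_def by (simp add: strongly_measurable_iff_borel)
qed

lemma selection_lift_subset_Lp_space: "selection_lift M p x0 C \<subseteq> Lp_space M p x0"
  unfolding selection_lift_def Lp_space_def Lp_class_def by (auto intro: quotientI)

section \<open>Compactness forces a single value on the nonatomic part\<close>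

text \<open>
  The contradiction with total boundedness described at the beginning. The factor \<open>3\<close> ensures that
  points of the two closed balls have distance more than \<open>\<rho>\<close>.
\<close>
lemma (in finite_measure) compact_lift_imp_two_ball_null:
  fixes C :: "'a \<Rightarrow> 'x::polish_space set"
  assumes p: "1 \<le> p" and C: "measurable_multifunction M C" and bd: "p_integrably_bounded M p x0 C"
    and comp: "compactin (Lp_topology M p x0) (selection_lift M p x0 C)"
    and D: "nonatomic_on M D" and \<rho>: "0 < \<rho>" "3 * \<rho> < dist a b"
  shows "{\<omega>\<in>D. C \<omega> \<inter> ball a \<rho> \<noteq> {} \<and> C \<omega> \<inter> ball b \<rho> \<noteq> {}} \<in> null_sets M"
proof -
  define B where "B = {\<omega>\<in>D. C \<omega> \<inter> ball a \<rho> \<noteq> {} \<and> C \<omega> \<inter> ball b \<rho> \<noteq> {}}"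
  have D_sets: "D \<in> sets M" "D \<subseteq> space M"
    using D sets.sets_into_space unfolding nonatomic_on_def by auto
  have hit: "{\<omega>\<in>space M. C \<omega> \<inter> ball x \<rho> \<noteq> {}} \<in> sets M" for x
    using C unfolding measurable_multifunction_def by blast
  have "B = D \<inter> {\<omega>\<in>space M. C \<omega> \<inter> ball a \<rho> \<noteq> {}} \<inter> {\<omega>\<in>space M. C \<omega> \<inter> ball b \<rho> \<noteq> {}}"
    using D_sets unfolding B_def by auto
  then have B: "B \<in> sets M" "B \<subseteq> D" using D_sets hit[of a] hit[of b] by auto
  have "measure M B = 0"
  proof (rule ccontr)
    assume "measure M B \<noteq> 0"
    then have pos: "0 < measure M B" by (simp add: zero_less_measure_iff)
    obtain u where u[measurable]: "u \<in> borel_measurable M"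
      and uC: "\<And>\<omega>. \<omega> \<in> space M \<Longrightarrow> u \<omega> \<in> C \<omega>"
      and uV: "\<And>\<omega>. \<omega> \<in> space M \<Longrightarrow> C \<omega> \<inter> ball a \<rho> \<noteq> {} \<Longrightarrow> u \<omega> \<in> closure (ball a \<rho>)"
      using measurable_selection_hitting[OF C open_ball] by metis
    obtain v where v[measurable]: "v \<in> borel_measurable M"
      and vC: "\<And>\<omega>. \<omega> \<in> space M \<Longrightarrow> v \<omega> \<in> C \<omega>"
      and vV: "\<And>\<omega>. \<omega> \<in> space M \<Longrightarrow> C \<omega> \<inter> ball b \<rho> \<noteq> {} \<Longrightarrow> v \<omega> \<in> closure (ball b \<rho>)"
      using measurable_selection_hitting[OF C open_ball] by metis
    have closure_ball: "closure (ball x \<rho>) \<subseteq> cball x \<rho>" for x :: 'x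
      by (rule closure_minimal) auto
    have apart: "\<rho> \<le> dist (u \<omega>) (v \<omega>)" if "\<omega> \<in> B" for \<omega>
    proof -
      have "\<omega> \<in> space M" using that B D_sets by auto
      then have "dist a (u \<omega>) \<le> \<rho>" "dist b (v \<omega>) \<le> \<rho>"
        using that uV[of \<omega>] vV[of \<omega>] closure_ball unfolding B_def by (auto simp: subset_iff)
      then show ?thesis
        using \<rho>(2) dist_triangle[of a b "u \<omega>"] dist_triangle[of "u \<omega>" b "v \<omega>"]
        by (simp add: dist_commute)
    qed
    \<comment> \<open>The selection \<open>w\<close> below has distance at least \<open>\<rho> / 2\<close> from a point of the net on a third of \<open>B\<close>,
      and this is the resulting lower bound for the distance in $L^p$.\<close>
    define \<epsilon> where "\<epsilon> = \<rho> / 2 * (measure M B / 3) powr (1 / p)"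
    have "0 < \<epsilon>" using pos \<rho> unfolding \<epsilon>_def by simp
    interpret L: Metric_space "Lp_space M p x0" "Lp_dist M p"
      using p by (rule Metric_space_Lp)
    have "L.mtotally_bounded (selection_lift M p x0 C)"
      using comp unfolding Lp_topology_def by (rule L.compactin_imp_mtotally_bounded)
    then obtain K where K: "finite K" "K \<subseteq> selection_lift M p x0 C"
      "selection_lift M p x0 C \<subseteq> (\<Union>U\<in>K. L.mball U \<epsilon>)"
      using \<open>0 < \<epsilon>\<close> unfolding L.mtotally_bounded_def by meson
    have "\<forall>U\<in>K. \<exists>g. g \<in> Lp_fun M p x0 \<and> U = Lp_class M p x0 g"
      using K(2) unfolding selection_lift_def by blast
    then obtain g where g: "\<And>U. U \<in> K \<Longrightarrow> g U \<in> Lp_fun M p x0"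
      "\<And>U. U \<in> K \<Longrightarrow> U = Lp_class M p x0 (g U)"
      by metis
    have g_meas: "g U \<in> borel_measurable M" if "U \<in> K" for U
      using g(1)[OF that] by (auto simp: Lp_fun_def strongly_measurable_iff_borel)
    define nearu where "nearu U = {\<omega>\<in>space M. dist (g U \<omega>) (u \<omega>) < dist (g U \<omega>) (v \<omega>)}" for U
    have "nearu U \<in> sets M" if "U \<in> K" for U
    proof -
      note [measurable] = g_meas[OF that]
      show ?thesis unfolding nearu_def by measurable
    qed
    then obtain E where E: "E \<in> sets M" "E \<subseteq> B"
      "\<And>U. U \<in> K \<Longrightarrow> measure M B / 3 \<le> measure M ((E - nearu U) \<union> (B \<inter> nearu U - E))"
      using nonatomic_on_split_finite_family[OF D, of "nearu ` K" B] K(1) B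
      by (metis (no_types, lifting) finite_imageI image_subset_iff image_eqI)
    define w where "w \<omega> = (if \<omega> \<in> E then u \<omega> else v \<omega>)" for \<omega>
    note [measurable] = E(1)
    have w_meas: "w \<in> borel_measurable M" unfolding w_def by measurable
    have w_sel: "AE \<omega> in M. w \<omega> \<in> C \<omega>" using uC vC by (auto simp: w_def)
    have w: "w \<in> Lp_fun M p x0" by (rule selection_in_Lp_fun[OF p bd w_meas w_sel])
    then have "Lp_class M p x0 w \<in> selection_lift M p x0 C"
      using w_sel unfolding selection_lift_def by blast
    then obtain U where U: "U \<in> K" "Lp_dist M p U (Lp_class M p x0 w) < \<epsilon>"
      using K(3) by (auto simp: L.mball_def)
    have small: "Lp_fun_dist M p (g U) w < \<epsilon>"
      using U(2) Lp_dist_class[OF g(1)[OF U(1)] w] g(2)[OF U(1)] by simp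
    define P where "P = (E - nearu U) \<union> (B \<inter> nearu U - E)"
    have P: "P \<in> sets M" "measure M B / 3 \<le> measure M P"
      using E(3)[OF U(1)] E(1) B(1) \<open>\<And>U. U \<in> K \<Longrightarrow> nearu U \<in> sets M\<close>[OF U(1)]
      unfolding P_def by auto
    have far: "\<rho> / 2 \<le> dist (g U \<omega>) (w \<omega>)" if "\<omega> \<in> P" for \<omega>
    proof -
      have "\<omega> \<in> B" "\<omega> \<in> space M" using that E(2) B D_sets unfolding P_def by auto
      then show ?thesis
        using that apart[of \<omega>] dist_triangle[of "u \<omega>" "v \<omega>" "g U \<omega>"]
        unfolding P_def w_def nearu_def by (auto simp: dist_commute)
    qed
    have int: "integrable M (\<lambda>\<omega>. dist (g U \<omega>) (w \<omega>) powr p)"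
      by (rule Lp_fun_dist_integrable[OF p g(1)[OF U(1)] w])
    have "(\<rho> / 2) powr p * measure M P = (\<integral>\<omega>. (\<rho> / 2) powr p * indicator P \<omega> \<partial>M)"
      using P(1) sets.sets_into_space[OF P(1)] by (simp add: Int_absorb2)
    also have "\<dots> \<le> (\<integral>\<omega>. dist (g U \<omega>) (w \<omega>) powr p \<partial>M)"
    proof (rule integral_mono)
      show "integrable M (\<lambda>\<omega>. (\<rho> / 2) powr p * indicator P \<omega>)"
        using P(1) by (auto simp: emeasure_eq_measure)
      fix \<omega>
      show "(\<rho> / 2) powr p * indicator P \<omega> \<le> dist (g U \<omega>) (w \<omega>) powr p"
        using far[of \<omega>] \<rho> p by (auto simp: indicator_def intro!: powr_mono2)
    qed (rule int)
    finally have "(\<rho> / 2) powr p * (measure M B / 3) \<le> (\<integral>\<omega>. dist (g U \<omega>) (w \<omega>) powr p \<partial>M)"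
      using mult_left_mono[OF P(2), of "(\<rho> / 2) powr p"] by simp
    then have "((\<rho> / 2) powr p * (measure M B / 3)) powr (1 / p) \<le> Lp_fun_dist M p (g U) w"
      unfolding Lp_fun_dist_def using p by (intro powr_mono2) auto
    moreover have "((\<rho> / 2) powr p * (measure M B / 3)) powr (1 / p) = \<epsilon>"
      unfolding \<epsilon>_def using p \<rho> by (subst powr_mult) (simp add: powr_powr)
    ultimately show False using small by simp
  qed
  then show ?thesis unfolding B_def[symmetric] using B by (auto simp: emeasure_eq_measure)
qed

text \<open>
  Two different points of \<open>C \<omega>\<close> lie in two well separated balls with centres in a dense sequence and
  radius \<open>1 / Suc n\<close>. There are only countably many such pairs of balls, and each of them contributes
  a null set.
\<close>
lemma (in finite_measure) compact_lift_imp_singleton: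
  fixes C :: "'a \<Rightarrow> 'x::polish_space set"
  assumes p: "1 \<le> p" and C: "measurable_multifunction M C" and bd: "p_integrably_bounded M p x0 C"
    and comp: "compactin (Lp_topology M p x0) (selection_lift M p x0 C)"
    and D: "nonatomic_on M D"
  shows "AE \<omega> in M. \<omega> \<in> D \<longrightarrow> is_singleton (C \<omega>)"
proof -
  obtain q :: "nat \<Rightarrow> 'x" where q: "\<And>x e. 0 < e \<Longrightarrow> \<exists>n. dist (q n) x < e"
    using dense_sequence_exists by blast
  have null: "AE \<omega> in M. 3 * (1 / real (Suc n)) < dist (q i) (q j) \<longrightarrow> \<omega> \<in> D \<longrightarrow>
      C \<omega> \<inter> ball (q i) (1 / real (Suc n)) = {} \<or> C \<omega> \<inter> ball (q j) (1 / real (Suc n)) = {}" for n i j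
  proof (cases "3 * (1 / real (Suc n)) < dist (q i) (q j)")
    case True
    show ?thesis
      using AE_not_in[OF compact_lift_imp_two_ball_null[OF p C bd comp D _ True]] by simp
  qed simp
  then have "AE \<omega> in M. \<forall>n i j. 3 * (1 / real (Suc n)) < dist (q i) (q j) \<longrightarrow> \<omega> \<in> D \<longrightarrow>
      C \<omega> \<inter> ball (q i) (1 / real (Suc n)) = {} \<or> C \<omega> \<inter> ball (q j) (1 / real (Suc n)) = {}"
    by (intro AE_all_countable[THEN iffD2] allI null)
  with AE_space show ?thesis
  proof eventually_elim
    case (elim \<omega>)
    show ?case
    proof (intro impI is_singletonI')
      show "C \<omega> \<noteq> {}" using C elim(1) unfolding measurable_multifunction_def by blast
      fix x y assume "\<omega> \<in> D" "x \<in> C \<omega>" "y \<in> C \<omega>"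
      show "x = y"
      proof (rule ccontr)
        assume "x \<noteq> y"
        \<comment> \<open>Moving to the centres costs two radii, and the centres have to be three radii apart.\<close>
        then obtain n where n: "1 / real (Suc n) < dist x y / 5"
          using nat_approx_posE[of "dist x y / 5"] by auto
        obtain i j where ij: "dist (q i) x < 1 / real (Suc n)" "dist (q j) y < 1 / real (Suc n)"
          using q[of "1 / real (Suc n)"] by force
        then have "3 * (1 / real (Suc n)) < dist (q i) (q j)"
          using n dist_triangle[of x y "q i"] dist_triangle[of "q i" y "q j"]
          by (simp add: dist_commute)
        then show False
          using elim(2) ij \<open>\<omega> \<in> D\<close> \<open>x \<in> C \<omega>\<close> \<open>y \<in> C \<omega>\<close> by (fastforce simp: disjoint_iff)
      qed
    qed
  qed
qed

section \<open>Selections on atoms\<close>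

lemma ex_in_of_AE:
  assumes "A \<in> sets M" "0 < emeasure M A" "AE \<omega> in M. P \<omega>"
  shows "\<exists>\<omega>\<in>A. P \<omega>"
proof (rule ccontr)
  assume "\<not> ?thesis"
  then have "AE \<omega> in M. \<omega> \<notin> A" using assms(3) by (auto elim: eventually_mono)
  then show False using assms(1,2) by (simp add: AE_iff_null_sets[symmetric] null_setsD1)
qed

text \<open>
  On an atom, each member of a countable basis contains \<open>u \<omega>\<close> either for almost every \<open>\<omega>\<close> or for
  almost none. Outside one null set all values therefore lie in the same basic open sets, and these
  separate points.
\<close>
lemma (in finite_measure) AE_constant_on_atom:
  fixes u :: "'a \<Rightarrow> 'x::{second_countable_topology, t1_space}"
  assumes A: "is_atom M A" and [measurable]: "u \<in> borel_measurable M"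
  shows "\<exists>c. AE \<omega> in M. \<omega> \<in> A \<longrightarrow> u \<omega> = c"
proof -
  obtain \<B> :: "'x set set" where \<B>: "countable \<B>" "topological_basis \<B>"
    using ex_countable_basis by blast
  have A_sets[measurable]: "A \<in> sets M" and A_pos: "0 < emeasure M A"
    using A unfolding is_atom_def by auto
  define mostly where "mostly V \<longleftrightarrow> emeasure M (A \<inter> (u -` V \<inter> space M)) \<noteq> 0" for V
  have "AE \<omega> in M. \<omega> \<in> A \<longrightarrow> (u \<omega> \<in> V \<longleftrightarrow> mostly V)" if "V \<in> \<B>" for V
  proof -
    have [measurable]: "V \<in> sets borel" using topological_basis_open[OF \<B>(2) that] by simp
    define W where "W = A \<inter> (u -` V \<inter> space M)"
    have W: "W \<in> sets M" "W \<subseteq> A" unfolding W_def by measurable auto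
    show ?thesis
    proof (cases "mostly V")
      case True
      then have "emeasure M W = emeasure M A"
        using A W unfolding is_atom_def mostly_def W_def[symmetric] by blast
      then have "A - W \<in> null_sets M"
        using W by (auto simp: null_sets_def emeasure_Diff)
      from AE_not_in[OF this] show ?thesis
        using True unfolding W_def by (auto elim: eventually_mono)
    next
      case False
      then have "W \<in> null_sets M" using W unfolding mostly_def W_def[symmetric] by auto
      from AE_not_in[OF this] AE_space show ?thesis
        by eventually_elim (use False in \<open>auto simp: W_def\<close>)
    qed
  qed
  then have ae: "AE \<omega> in M. \<forall>V\<in>\<B>. \<omega> \<in> A \<longrightarrow> (u \<omega> \<in> V \<longleftrightarrow> mostly V)"
    by (subst AE_ball_countable[OF \<B>(1)]) blast
  then obtain z where z: "z \<in> A" "\<forall>V\<in>\<B>. u z \<in> V \<longleftrightarrow> mostly V"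
    using ex_in_of_AE[OF A_sets A_pos ae] by blast
  have "AE \<omega> in M. \<omega> \<in> A \<longrightarrow> u \<omega> = u z"
    using ae
  proof eventually_elim
    case (elim \<omega>)
    show ?case
    proof (intro impI, rule ccontr)
      assume "\<omega> \<in> A" "u \<omega> \<noteq> u z"
      then obtain V where "V \<in> \<B>" "u z \<in> V" "V \<subseteq> - {u \<omega>}"
        using topological_basisE[OF \<B>(2), of "- {u \<omega>}" "u z"] by auto
      then show False using elim z(2) \<open>\<omega> \<in> A\<close> by blast
    qed
  qed
  then show ?thesis by blast
qed

section \<open>Convergence of selections\<close>

text \<open>
  By Tychonoff's theorem the product of the \<open>K j\<close> is compact; a countable product is second
  countable, so it is also sequentially compact.
\<close>
lemma compact_sequences_common_subsequence:
  fixes x :: "nat \<Rightarrow> nat \<Rightarrow> 'x::{metric_space, second_countable_topology}"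
  assumes K: "\<And>j. compact (K j)" and x: "\<And>n j. x n j \<in> K j"
  obtains r :: "nat \<Rightarrow> nat" where "strict_mono r" "\<And>j. convergent (\<lambda>k. x (r k) j)"
proof -
  have "compactin (product_topology (\<lambda>_. euclidean) UNIV) (PiE UNIV K)"
    using K by (subst compactin_PiE) (auto simp: compactin_euclidean_iff)
  then have "compact (PiE UNIV K)"
    by (simp add: euclidean_product_topology compactin_euclidean_iff)
  then have "seq_compact (PiE UNIV K)" by (simp add: seq_compact_eq_compact)
  then obtain l r where r: "strict_mono (r :: nat \<Rightarrow> nat)" "(x \<circ> r) \<longlonglongrightarrow> l"
    using x by (elim seq_compactE[of _ x]) (auto simp: PiE_UNIV_domain)
  have "(\<lambda>k. x (r k) j) \<longlonglongrightarrow> l j" for j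
    using continuous_on_tendsto_compose[OF continuous_on_product_coordinates[of j] r(2)]
    by (simp add: o_def)
  then show thesis using that r(1) unfolding convergent_def by blast
qed

text \<open>
  On the nonatomic part the sequence does not depend on \<open>n\<close>, and on an atom it coincides with its
  values at one sample point of the atom, which lie in the compact value of \<open>C\<close> there. It is therefore
  enough to find a subsequence that converges at the countably many sample points.
\<close>
lemma (in prob_space) selections_AE_convergent_subsequence:
  fixes C :: "'a \<Rightarrow> 'x::polish_space set"
  assumes dec: "atomic_decomposition M D \<A>"
    and comp: "\<And>\<omega>. \<omega> \<in> space M \<Longrightarrow> compact (C \<omega>)"
    and sing: "AE \<omega> in M. \<omega> \<in> D \<longrightarrow> is_singleton (C \<omega>)"
    and u: "\<And>n. u n \<in> borel_measurable M" and sel: "\<And>n. AE \<omega> in M. u n \<omega> \<in> C \<omega>"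
  obtains r :: "nat \<Rightarrow> nat" where "strict_mono r" "AE \<omega> in M. convergent (\<lambda>k. u (r k) \<omega>)"
proof -
  have \<A>: "countable \<A>" "\<And>A. A \<in> \<A> \<Longrightarrow> is_atom M A" and
    rest: "space M - (D \<union> \<Union>\<A>) \<in> null_sets M"
    using dec unfolding atomic_decomposition_def by auto
  have "\<forall>n A. A \<in> \<A> \<longrightarrow> (\<exists>c. AE \<omega> in M. \<omega> \<in> A \<longrightarrow> u n \<omega> = c)"
    using AE_constant_on_atom[OF \<A>(2) u] by blast
  then obtain c where c: "\<And>n A. A \<in> \<A> \<Longrightarrow> AE \<omega> in M. \<omega> \<in> A \<longrightarrow> u n \<omega> = c n A"
    by metis
  define good where "good \<omega> \<longleftrightarrow> \<omega> \<in> space M \<and> \<omega> \<in> D \<union> \<Union>\<A> \<and> (\<omega> \<in> D \<longrightarrow> is_singleton (C \<omega>)) \<and>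
    (\<forall>n. u n \<omega> \<in> C \<omega>) \<and> (\<forall>n. \<forall>A\<in>\<A>. \<omega> \<in> A \<longrightarrow> u n \<omega> = c n A)" for \<omega>
  have "AE \<omega> in M. \<forall>n. u n \<omega> \<in> C \<omega>" using sel by (simp add: AE_all_countable)
  moreover have "AE \<omega> in M. \<forall>n. \<forall>A\<in>\<A>. \<omega> \<in> A \<longrightarrow> u n \<omega> = c n A"
    using c \<A>(1) by (simp add: AE_all_countable AE_ball_countable)
  ultimately have good: "AE \<omega> in M. good \<omega>"
    using sing AE_space AE_not_in[OF rest] by eventually_elim (auto simp: good_def)
  \<comment> \<open>The whole space is included because an enumeration needs a nonempty family.\<close>
  define \<T> where "\<T> = insert (space M) \<A>"
  have \<T>: "countable \<T>" "\<T> \<noteq> {}" using \<A>(1) by (auto simp: \<T>_def)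
  have "\<exists>\<omega>\<in>T. good \<omega>" if "T \<in> \<T>" for T
    using that \<A>(2) good unfolding \<T>_def
    by (intro ex_in_of_AE) (auto simp: is_atom_def emeasure_space_1)
  then obtain pt where pt: "\<And>T. T \<in> \<T> \<Longrightarrow> pt T \<in> T \<and> good (pt T)" by metis
  define z where "z j = pt (from_nat_into \<T> j)" for j
  have z: "good (z j)" for j using pt from_nat_into[OF \<T>(2)] unfolding z_def by blast
  obtain r where r: "strict_mono r" "\<And>j. convergent (\<lambda>k. u (r k) (z j))"
  proof (rule compact_sequences_common_subsequence[of "\<lambda>j. C (z j)" "\<lambda>n j. u n (z j)"])
    show "compact (C (z j))" for j using z comp unfolding good_def by blast
    show "u n (z j) \<in> C (z j)" for n j using z unfolding good_def by blast
  qed blast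
  have "AE \<omega> in M. convergent (\<lambda>k. u (r k) \<omega>)"
    using good
  proof eventually_elim
    case (elim \<omega>)
    then consider "\<omega> \<in> D" | A where "A \<in> \<A>" "\<omega> \<in> A" unfolding good_def by blast
    then show ?case
    proof cases
      case 1
      then obtain y where "C \<omega> = {y}" using elim unfolding good_def by (auto elim: is_singletonE)
      then have "u n \<omega> = y" for n using elim unfolding good_def by blast
      then show ?thesis by (simp add: convergent_const)
    next
      case 2
      then have "A \<in> \<T>" by (simp add: \<T>_def)
      then obtain j where "from_nat_into \<T> j = A" using from_nat_into_surj[OF \<T>(1)] by blast
      then have "z j \<in> A" using pt[OF \<open>A \<in> \<T>\<close>] unfolding z_def by blast
      then have "u n \<omega> = u n (z j)" for n
        using elim z[of j] 2 unfolding good_def by metis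
      then show ?thesis using r(2)[of j] by simp
    qed
  qed
  then show thesis using that r(1) by blast
qed

lemma selections_Lp_tendsto:
  fixes u :: "nat \<Rightarrow> 'w \<Rightarrow> 'x::polish_space"
  assumes p: "1 \<le> p" and bd: "p_integrably_bounded M p x0 C"
    and u[measurable]: "\<And>n. u n \<in> borel_measurable M" and u_sel: "\<And>n. AE \<omega> in M. u n \<omega> \<in> C \<omega>"
    and v[measurable]: "v \<in> borel_measurable M" and v_sel: "AE \<omega> in M. v \<omega> \<in> C \<omega>"
    and lim: "AE \<omega> in M. (\<lambda>n. u n \<omega>) \<longlonglongrightarrow> v \<omega>"
  shows "(\<lambda>n. Lp_fun_dist M p (u n) v) \<longlonglongrightarrow> 0"
proof -
  define R where "R \<omega> = \<bar>SUP x\<in>C \<omega>. dist x x0\<bar>" for \<omega>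
  have "(\<lambda>n. \<integral>\<omega>. dist (u n \<omega>) (v \<omega>) powr p \<partial>M) \<longlonglongrightarrow> (\<integral>\<omega>. 0 \<partial>M)"
  proof (rule integral_dominated_convergence[where w = "\<lambda>\<omega>. 2 powr p * R \<omega> powr p"])
    show "(\<lambda>\<omega>. dist (u n \<omega>) (v \<omega>) powr p) \<in> borel_measurable M" for n by measurable
    show "integrable M (\<lambda>\<omega>. 2 powr p * R \<omega> powr p)"
      using bd unfolding p_integrably_bounded_def R_def by auto
    show "AE \<omega> in M. (\<lambda>n. dist (u n \<omega>) (v \<omega>) powr p) \<longlonglongrightarrow> 0"
      using lim
    proof eventually_elim
      case (elim \<omega>)
      then have "(\<lambda>n. dist (u n \<omega>) (v \<omega>)) \<longlonglongrightarrow> 0" by (rule tendsto_dist_iff[THEN iffD1])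
      then show ?case using p by (intro tendsto_zero_powrI[where b = p]) auto
    qed
    show "AE \<omega> in M. norm (dist (u n \<omega>) (v \<omega>) powr p) \<le> 2 powr p * R \<omega> powr p" for n
      using p_integrably_bounded_AE[OF bd] u_sel[of n] v_sel
    proof eventually_elim
      case (elim \<omega>)
      then have "dist (u n \<omega>) x0 \<le> R \<omega>" "dist (v \<omega>) x0 \<le> R \<omega>" unfolding R_def by auto
      then have "dist (u n \<omega>) (v \<omega>) \<le> 2 * R \<omega>"
        using dist_triangle2[of "u n \<omega>" "v \<omega>" x0] by simp
      then have "dist (u n \<omega>) (v \<omega>) powr p \<le> (2 * R \<omega>) powr p"
        using p by (intro powr_mono2) auto
      then show ?case by (simp add: powr_mult)
    qed
  qed simp
  then show ?thesis
    unfolding Lp_fun_dist_def using p by (intro tendsto_zero_powrI[where b = "1 / p"]) auto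
qed

lemma (in prob_space) singleton_imp_compact_lift:
  fixes C :: "'a \<Rightarrow> 'x::polish_space set"
  assumes p: "1 \<le> p" and bd: "p_integrably_bounded M p x0 C"
    and comp: "\<And>\<omega>. \<omega> \<in> space M \<Longrightarrow> compact (C \<omega>)"
    and dec: "atomic_decomposition M D \<A>"
    and sing: "AE \<omega> in M. \<omega> \<in> D \<longrightarrow> is_singleton (C \<omega>)"
  shows "compactin (Lp_topology M p x0) (selection_lift M p x0 C)"
proof -
  interpret L: Metric_space "Lp_space M p x0" "Lp_dist M p"
    using p by (rule Metric_space_Lp)
  show ?thesis
    unfolding Lp_topology_def L.compactin_sequentially
  proof (intro conjI allI impI selection_lift_subset_Lp_space)
    fix \<sigma> :: "nat \<Rightarrow> ('a \<Rightarrow> 'x) set" assume "range \<sigma> \<subseteq> selection_lift M p x0 C"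
    then have "\<forall>n. \<exists>u. u \<in> Lp_fun M p x0 \<and> (AE \<omega> in M. u \<omega> \<in> C \<omega>) \<and> \<sigma> n = Lp_class M p x0 u"
      unfolding selection_lift_def by blast
    then obtain u where u_Lp: "\<And>n. u n \<in> Lp_fun M p x0" and u_sel: "\<And>n. AE \<omega> in M. u n \<omega> \<in> C \<omega>"
      and \<sigma>: "\<And>n. \<sigma> n = Lp_class M p x0 (u n)"
      by metis
    have u: "u n \<in> borel_measurable M" for n
      using u_Lp[of n] by (auto simp: Lp_fun_def strongly_measurable_iff_borel)
    obtain r where r: "strict_mono (r :: nat \<Rightarrow> nat)" "AE \<omega> in M. convergent (\<lambda>k. u (r k) \<omega>)"
      by (rule selections_AE_convergent_subsequence[OF dec comp sing u u_sel])
    obtain N where N: "\<And>\<omega>. \<omega> \<in> space M - N \<Longrightarrow> convergent (\<lambda>k. u (r k) \<omega>)" "N \<in> null_sets M"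
      using AE_E3[OF r(2)] by metis
    have [measurable]: "N \<in> sets M" using N(2) by auto
    \<comment> \<open>Fixing the value \<open>x0\<close> on the exceptional null set makes \<open>v\<close> an everywhere limit of measurable
      functions.\<close>
    define v where "v \<omega> = (if \<omega> \<in> N then x0 else lim (\<lambda>k. u (r k) \<omega>))" for \<omega>
    have lim: "(\<lambda>k. u (r k) \<omega>) \<longlonglongrightarrow> v \<omega>" if "\<omega> \<in> space M - N" for \<omega>
      using N(1)[OF that] that unfolding v_def convergent_LIMSEQ_iff by simp
    have v: "v \<in> borel_measurable M"
    proof (rule borel_measurable_LIMSEQ_metric)
      show "(\<lambda>\<omega>. if \<omega> \<in> N then x0 else u (r k) \<omega>) \<in> borel_measurable M" for k
        using u[of "r k"] by measurable
      show "(\<lambda>k. if \<omega> \<in> N then x0 else u (r k) \<omega>) \<longlonglongrightarrow> v \<omega>" if "\<omega> \<in> space M" for \<omega>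
        using lim[of \<omega>] that by (cases "\<omega> \<in> N") (auto simp: v_def)
    qed
    have ae_lim: "AE \<omega> in M. (\<lambda>k. u (r k) \<omega>) \<longlonglongrightarrow> v \<omega>"
      using AE_space AE_not_in[OF N(2)] by eventually_elim (use lim in auto)
    have "AE \<omega> in M. \<forall>n. u n \<omega> \<in> C \<omega>" using u_sel by (simp add: AE_all_countable)
    with ae_lim AE_space have v_sel: "AE \<omega> in M. v \<omega> \<in> C \<omega>"
    proof eventually_elim
      case (elim \<omega>)
      then show ?case
        using closed_sequentially[OF compact_imp_closed[OF comp], of \<omega> "\<lambda>k. u (r k) \<omega>"] by auto
    qed
    have v_Lp: "v \<in> Lp_fun M p x0" by (rule selection_in_Lp_fun[OF p bd v v_sel])
    have "(\<lambda>k. Lp_fun_dist M p (u (r k)) v) \<longlonglongrightarrow> 0"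
      by (rule selections_Lp_tendsto[OF p bd u u_sel v v_sel ae_lim])
    then have dist_lim: "(\<lambda>k. Lp_dist M p ((\<sigma> \<circ> r) k) (Lp_class M p x0 v)) \<longlonglongrightarrow> 0"
      by (simp add: \<sigma> Lp_dist_class[OF u_Lp v_Lp])
    have v_lift: "Lp_class M p x0 v \<in> selection_lift M p x0 C"
      using v_Lp v_sel unfolding selection_lift_def by blast
    have "(\<sigma> \<circ> r) k \<in> Lp_space M p x0" for k
      using \<open>range \<sigma> \<subseteq> _\<close> selection_lift_subset_Lp_space by fastforce
    then have "limitin L.mtopology (\<sigma> \<circ> r) (Lp_class M p x0 v) sequentially"
      using dist_lim subsetD[OF selection_lift_subset_Lp_space v_lift]
      unfolding L.limitin_metric_dist_null by auto
    then show "\<exists>l r. l \<in> selection_lift M p x0 C \<and> strict_mono r \<and>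
        limitin L.mtopology (\<sigma> \<circ> r) l sequentially"
      using v_lift r(1) by blast
  qed
qed

section \<open>The characterisation\<close>

theorem theorem7p3:
  fixes M :: "'w measure" and p :: real and x0 :: "'x::polish_space" and C :: "'w \<Rightarrow> 'x set"
  assumes "standard_prob_space M"
    and "1 \<le> p"
    and "measurable_multifunction M C"
    and "\<forall>\<omega>\<in>space M. compact (C \<omega>)"
    and "p_integrably_bounded M p x0 C"
  shows "(\<forall>D \<A>. atomic_decomposition M D \<A> \<longrightarrow>
            (compactin (Lp_topology M p x0) (selection_lift M p x0 C) \<longleftrightarrow>
             (AE \<omega> in M. \<omega> \<in> D \<longrightarrow> is_singleton (C \<omega>)))) \<and>
         (purely_nonatomic M \<longrightarrow>
            (compactin (Lp_topology M p x0) (selection_lift M p x0 C) \<longleftrightarrow>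
             (AE \<omega> in M. is_singleton (C \<omega>))))"
proof -
  interpret prob_space M using assms(1) unfolding standard_prob_space_def by blast
  have iff: "compactin (Lp_topology M p x0) (selection_lift M p x0 C) \<longleftrightarrow>
      (AE \<omega> in M. \<omega> \<in> D \<longrightarrow> is_singleton (C \<omega>))" if dec: "atomic_decomposition M D \<A>" for D \<A>
  proof
    assume "compactin (Lp_topology M p x0) (selection_lift M p x0 C)"
    moreover have "nonatomic_on M D" using dec unfolding atomic_decomposition_def by blast
    ultimately show "AE \<omega> in M. \<omega> \<in> D \<longrightarrow> is_singleton (C \<omega>)"
      by (rule compact_lift_imp_singleton[OF assms(2,3,5)])
  next
    assume "AE \<omega> in M. \<omega> \<in> D \<longrightarrow> is_singleton (C \<omega>)"
    then show "compactin (Lp_topology M p x0) (selection_lift M p x0 C)"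
      using singleton_imp_compact_lift[OF assms(2,5) _ dec] assms(4) by blast
  qed
  moreover have "compactin (Lp_topology M p x0) (selection_lift M p x0 C) \<longleftrightarrow>
      (AE \<omega> in M. is_singleton (C \<omega>))" if "purely_nonatomic M"
  proof -
    have "atomic_decomposition M (space M) {}"
      using that unfolding atomic_decomposition_def by simp
    from iff[OF this] show ?thesis
      by (simp add: AE_conj_iff cong: AE_cong)
  qed
  ultimately show ?thesis by blast
qed

end
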